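(* Let $-1<a<0$ and let $C_a$ be the Chebyshev's method of $p_a(z)=(z^2-1)(z^2-a)$. All the extraneous fixed points of $C_a$ are repelling.
   Context: For a polynomial $p$, the Chebyshev's method of $p$ is the rational map $C_p(z)=z-\left[1+\frac12 L_p(z)\right]\frac{p(z)}{p'(z)}$ with $L_p(z)=\frac{p(z)p''(z)}{(p'(z))^2}$. For $p_a(z)=(z^2-1)(z^2-a)$ write $C_a:=C_{p_a}$. An extraneous fixed point of $C_a$ is a finite fixed point of $C_a$ that is not a root of $p_a$; equivalently, the extraneous fixed points are the solutions of $22z^6-23(a+1)z^4+(5a^2+16a+5)z^2-a(a+1)=0$. A fixed point $z_0\in\mathbb C$ is repelling if $|C_a'(z_0)|>1$. *)

theory Defs
  imports "HOL-Complex_Analysis.Complex_Analysis"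
begin

definition L_factor :: "complex poly \<Rightarrow> complex \<Rightarrow> complex" where
  "L_factor p z = poly p z * poly (pderiv (pderiv p)) z / (poly (pderiv p) z)\<^sup>2"

text \<open>
  At a zero of \<open>p'\<close> this expression takes a junk value (division by zero yields
  \<open>chebyshev p z = z\<close>).  The notions below depend only on the values of the map near,
  but not at, the point in question, so that they describe the rational map itself,
  with its poles and with removable singularities (e.g. at multiple roots of \<open>p\<close>) filled in.
\<close>
definition chebyshev :: "complex poly \<Rightarrow> complex \<Rightarrow> complex" where
  "chebyshev p z = z - (1 + 1/2 * L_factor p z) * (poly p z / poly (pderiv p) z)"

text \<open>
  The constraint on poles is needed because \<^const>\<open>remove_sings\<close> is \<open>0\<close> at a pole, so that
  a pole at \<open>0\<close> (which does occur for \<open>p_a\<close> below) would otherwise count as a fixed point.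
\<close>
definition finite_fixed_point :: "(complex \<Rightarrow> complex) \<Rightarrow> complex \<Rightarrow> bool" where
  "finite_fixed_point f z \<longleftrightarrow> \<not> is_pole f z \<and> remove_sings f z = z"

definition repelling_fixed_point :: "(complex \<Rightarrow> complex) \<Rightarrow> complex \<Rightarrow> bool" where
  "repelling_fixed_point f z \<longleftrightarrow>
     finite_fixed_point f z \<and> cmod (deriv (remove_sings f) z) > 1"

definition extraneous_fixed_point :: "complex poly \<Rightarrow> complex \<Rightarrow> bool" where
  "extraneous_fixed_point p z \<longleftrightarrow> finite_fixed_point (chebyshev p) z \<and> poly p z \<noteq> 0"

definition p_a :: "complex \<Rightarrow> complex poly" where
  "p_a a = ([:0, 1:]\<^sup>2 - [:1:]) * ([:0, 1:]\<^sup>2 - [:a:])"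

end

theory Submission
  imports Defs
begin

text \<open>
  Away from the critical points of \<open>p\<close>, which for \<open>p_a\<close> are poles of the Chebyshev map, the
  extraneous fixed points are the solutions of \<open>L_p = -2\<close>, and the multiplier there is
  \<open>2 (3 - p' p''' / p''\<^sup>2)\<close>.  For \<open>p_a\<close>, put \<open>w = z\<^sup>2\<close> and \<open>s = a + 1\<close>.  The sextic is a cubic in \<open>w\<close>;
  divided by \<open>w (2 w - s)\<close> it becomes \<open>11 w - 6 s + a / w + (2 a - s\<^sup>2 / 2) / (w - s / 2)\<close>, whose
  residues are negative for \<open>a < 0\<close>, so all its zeros are real.  At real \<open>w\<close> the
  multiplier \<open>6 (28 w\<^sup>2 - 8 s w + s\<^sup>2) / (6 w - s)\<^sup>2\<close> exceeds 1, because
  \<open>132 w\<^sup>2 - 36 s w + 5 s\<^sup>2\<close> is positive definite.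
\<close>

text \<open>This is \<open>L\<^sup>2 / 2 * (3 - p' p''' / p''\<^sup>2)\<close> with the division by
  \<open>p''\<close> cleared, so that the formula also covers zeros of \<open>p''\<close>.\<close>

lemma has_field_derivative_chebyshev:
  assumes "poly (pderiv p) z \<noteq> 0"
  shows "(chebyshev p has_field_derivative
     (poly p z)\<^sup>2 * (3 * (poly (pderiv (pderiv p)) z)\<^sup>2
       - poly (pderiv p) z * poly (pderiv (pderiv (pderiv p))) z)
     / (2 * (poly (pderiv p) z) ^ 4)) (at z)"
  unfolding chebyshev_def[abs_def] L_factor_def
  using assms
  by (auto intro!: derivative_eq_intros poly_DERIV)
     (simp add: divide_simps, simp add: algebra_simps eval_nat_numeral)

lemma chebyshev_analytic_at:
  assumes "poly (pderiv p) z \<noteq> 0"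
  shows "chebyshev p analytic_on {z}"
proof -
  have poly_analytic: "(\<lambda>w. poly q w) analytic_on {z}" for q :: "complex poly"
    by (rule holomorphic_on_imp_analytic_at[of _ UNIV]) (auto intro!: holomorphic_intros)
  show ?thesis
    unfolding chebyshev_def[abs_def] L_factor_def
    using assms by (intro analytic_intros poly_analytic) auto
qed

text \<open>At a critical point the formula takes the junk value \<open>z\<close>, which looks like
  a fixed point; this lemma rules out such spurious solutions.\<close>

lemma chebyshev_pole_at_simple_critical_point:
  assumes crit: "poly (pderiv p) z = 0"
    and nz: "poly p z \<noteq> 0" "poly (pderiv (pderiv p)) z \<noteq> 0"
  shows "is_pole (chebyshev p) z"
proof -
  have "pderiv p \<noteq> 0"
    using nz(2) by auto
  then have "finite {w. poly (pderiv p) w = 0}"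
    by (rule poly_roots_finite)
  then have ev: "\<forall>\<^sub>F w in at z. poly (pderiv p) w \<noteq> 0"
    using islimpt_finite[of "{w. poly (pderiv p) w = 0}" z]
    by (simp add: islimpt_iff_eventually)
  \<comment> \<open>Over the common denominator \<open>2 p'\<^sup>3\<close>, the numerator at
    \<open>z\<close> reduces to \<open>- p\<^sup>2 p''\<close>, which is nonzero.\<close>
  let ?num = "\<lambda>w. 2 * w * poly (pderiv p) w ^ 3
    - (2 * (poly (pderiv p) w)\<^sup>2 + poly p w * poly (pderiv (pderiv p)) w) * poly p w"
  let ?den = "\<lambda>w. 2 * poly (pderiv p) w ^ 3"
  have "(?den \<longlongrightarrow> ?den z) (at z)"
    by (intro tendsto_intros)
  then have "filterlim ?den (at 0) (at z)"
    unfolding filterlim_at using ev crit by (auto elim: eventually_mono)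
  moreover have "isCont ?num z"
    by (intro continuous_intros)
  ultimately have "is_pole (\<lambda>w. ?num w / ?den w) z"
    using crit nz by (intro is_pole_divide) auto
  moreover have "\<forall>\<^sub>F w in at z. ?num w / ?den w = chebyshev p w"
    using ev
    by eventually_elim
       (simp add: chebyshev_def L_factor_def divide_simps,
        simp add: algebra_simps eval_nat_numeral)
  ultimately show ?thesis
    by (rule is_pole_transform) simp
qed

text \<open>Analyticity makes \<open>remove_sings\<close> harmless at \<open>z\<close>. Since
  \<open>p / p'\<close> is nonzero there, the fixed point equation reduces to
  \<open>1 + L / 2 = 0\<close>, here cleared of denominators.\<close>

lemma extraneous_fixed_point_noncritical:
  assumes "poly (pderiv p) z \<noteq> 0"
  shows "extraneous_fixed_point p z \<longleftrightarrow> poly p z \<noteq> 0 \<and>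
    poly p z * poly (pderiv (pderiv p)) z = - 2 * (poly (pderiv p) z)\<^sup>2"
proof -
  have an: "chebyshev p analytic_on {z}"
    using chebyshev_analytic_at[OF assms] .
  have "\<not> is_pole (chebyshev p) z"
    using an analytic_at_imp_no_pole by blast
  moreover have "remove_sings (chebyshev p) z = chebyshev p z"
    using an by simp
  moreover have "chebyshev p z = z \<longleftrightarrow>
      poly p z * poly (pderiv (pderiv p)) z = - 2 * (poly (pderiv p) z)\<^sup>2"
    if "poly p z \<noteq> 0"
  proof -
    have "chebyshev p z = z \<longleftrightarrow> 1 + 1/2 * L_factor p z = 0"
      using that assms by (simp add: chebyshev_def)
    also have "\<dots> \<longleftrightarrow>
        poly p z * poly (pderiv (pderiv p)) z = - 2 * (poly (pderiv p) z)\<^sup>2"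
      using assms by (simp add: L_factor_def divide_simps eq_neg_iff_add_eq_0 add.commute)
    finally show ?thesis .
  qed
  ultimately show ?thesis
    unfolding extraneous_fixed_point_def finite_fixed_point_def by auto
qed

lemma deriv_chebyshev_extraneous:
  assumes ext: "extraneous_fixed_point p z" and nc: "poly (pderiv p) z \<noteq> 0"
  shows "deriv (remove_sings (chebyshev p)) z =
    2 * (3 - poly (pderiv p) z * poly (pderiv (pderiv (pderiv p))) z
       / (poly (pderiv (pderiv p)) z)\<^sup>2)"
proof -
  have "deriv (remove_sings (chebyshev p)) z = deriv (chebyshev p) z"
    using eventually_remove_sings_eq_nhds[OF chebyshev_analytic_at[OF nc]]
    by (rule deriv_cong_ev) simp
  also have "\<dots> = (poly p z)\<^sup>2 * (3 * (poly (pderiv (pderiv p)) z)\<^sup>2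
       - poly (pderiv p) z * poly (pderiv (pderiv (pderiv p))) z)
     / (2 * (poly (pderiv p) z) ^ 4)"
    using has_field_derivative_chebyshev[OF nc] by (rule DERIV_imp_deriv)
  also have "\<dots> = 2 * (3 - poly (pderiv p) z * poly (pderiv (pderiv (pderiv p))) z
       / (poly (pderiv (pderiv p)) z)\<^sup>2)"
  proof -
    have L: "poly p z * poly (pderiv (pderiv p)) z = - 2 * (poly (pderiv p) z)\<^sup>2"
      using ext extraneous_fixed_point_noncritical[OF nc] by blast
    then have nz: "poly (pderiv (pderiv p)) z \<noteq> 0"
      using nc by auto
    \<comment> \<open>Squaring the fixed point equation expresses \<open>p\<^sup>2\<close> through
      \<open>p'\<close> and \<open>p''\<close>, which eliminates \<open>p\<close> from the
      multiplier.\<close>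
    have "(poly p z)\<^sup>2 * (poly (pderiv (pderiv p)) z)\<^sup>2 = 4 * poly (pderiv p) z ^ 4"
      using arg_cong[OF L, of "\<lambda>t. t\<^sup>2"] by (simp add: power_mult_distrib)
    then have "(poly p z)\<^sup>2 = 4 * poly (pderiv p) z ^ 4 / (poly (pderiv (pderiv p)) z)\<^sup>2"
      using nz by (simp add: field_simps)
    then show ?thesis
      using nc nz by (simp add: field_simps)
  qed
  finally show ?thesis .
qed

lemma poly_p_a:
  "poly (p_a a) z = (z\<^sup>2 - 1) * (z\<^sup>2 - a)"
  "poly (pderiv (p_a a)) z = 2 * z * (2 * z\<^sup>2 - (a + 1))"
  "poly (pderiv (pderiv (p_a a))) z = 2 * (6 * z\<^sup>2 - (a + 1))"
  "poly (pderiv (pderiv (pderiv (p_a a)))) z = 24 * z"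
proof -
  have "p_a a = [:a, 0, - (a + 1), 0, 1:]"
    by (simp add: p_a_def power2_eq_square one_pCons algebra_simps)
  then show "poly (p_a a) z = (z\<^sup>2 - 1) * (z\<^sup>2 - a)"
    "poly (pderiv (p_a a)) z = 2 * z * (2 * z\<^sup>2 - (a + 1))"
    "poly (pderiv (pderiv (p_a a))) z = 2 * (6 * z\<^sup>2 - (a + 1))"
    "poly (pderiv (pderiv (pderiv (p_a a)))) z = 24 * z"
    by (simp_all add: pderiv_pCons algebra_simps power2_eq_square)
qed

text \<open>At the critical points, \<open>z = 0\<close> and \<open>z\<^sup>2 = (a + 1) / 2\<close>,
  half of \<open>p''\<close> equals \<open>- (a + 1)\<close> or \<open>2 * (a + 1)\<close>. Both are
  nonzero because \<open>a > -1\<close>, so an extraneous fixed point at a critical point would be a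
  pole.\<close>

lemma p_a_extraneous_noncritical:
  fixes a :: real
  assumes a: "-1 < a" "a < 0"
    and ext: "extraneous_fixed_point (p_a (complex_of_real a)) z"
  shows "poly (pderiv (p_a (complex_of_real a))) z \<noteq> 0"
proof
  assume crit: "poly (pderiv (p_a (complex_of_real a))) z = 0"
  then have "z = 0 \<or> 2 * z\<^sup>2 = complex_of_real a + 1"
    by (simp add: poly_p_a)
  then have "6 * z\<^sup>2 - (complex_of_real a + 1) = of_real (- (a + 1)) \<or>
      6 * z\<^sup>2 - (complex_of_real a + 1) = of_real (2 * (a + 1))"
  proof
    assume "2 * z\<^sup>2 = complex_of_real a + 1"
    moreover have "6 * z\<^sup>2 = 3 * (2 * z\<^sup>2)"
      by simp
    ultimately have "6 * z\<^sup>2 = 3 * (complex_of_real a + 1)"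
      by simp
    then show ?thesis
      by simp
  qed simp
  moreover have "complex_of_real (- (a + 1)) \<noteq> 0" "complex_of_real (2 * (a + 1)) \<noteq> 0"
    using a by (simp_all only: of_real_eq_0_iff) simp_all
  ultimately have "6 * z\<^sup>2 - (complex_of_real a + 1) \<noteq> 0"
    by metis
  then have "poly (pderiv (pderiv (p_a (complex_of_real a)))) z \<noteq> 0"
    unfolding poly_p_a mult_eq_0_iff by simp
  then have "is_pole (chebyshev (p_a (complex_of_real a))) z"
    using ext crit chebyshev_pole_at_simple_critical_point
    by (auto simp: extraneous_fixed_point_def)
  then show False
    using ext by (simp add: extraneous_fixed_point_def finite_fixed_point_def)
qed

text \<open>
  Each non-constant summand of the equation maps the upper half-plane into itself.
\<close>
lemma pick_function_zero_real:
  fixes w :: complex and m b c d e :: real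
  assumes "m > 0" "c < 0" "d < 0"
    and nz: "w \<noteq> 0" "w \<noteq> of_real e"
    and eq: "of_real m * w + of_real b + of_real c / w + of_real d / (w - of_real e) = 0"
  shows "Im w = 0"
proof (rule ccontr)
  assume y: "Im w \<noteq> 0"
  have "Im (of_real c / w) = - c / (cmod w)\<^sup>2 * Im w"
    "Im (of_real d / (w - of_real e)) = - d / (cmod (w - of_real e))\<^sup>2 * Im w"
    by (simp_all add: Im_divide cmod_power2)
  then have "Im w * (m - c / (cmod w)\<^sup>2 - d / (cmod (w - of_real e))\<^sup>2) = 0"
    using arg_cong[OF eq, of Im] by (simp add: algebra_simps)
  moreover have "c / (cmod w)\<^sup>2 < 0" "d / (cmod (w - of_real e))\<^sup>2 < 0"
    using assms by (auto intro!: divide_neg_pos)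
  ultimately show False
    using y \<open>m > 0\<close> by auto
qed

lemma p_a_extraneous_square_real:
  fixes a :: real
  assumes a: "-1 < a" "a < 0"
    and ext: "extraneous_fixed_point (p_a (complex_of_real a)) z"
  shows "Im (z\<^sup>2) = 0"
proof -
  define w where "w = z\<^sup>2"
  define A where "A = complex_of_real a"
  have nc: "poly (pderiv (p_a (complex_of_real a))) z \<noteq> 0"
    using p_a_extraneous_noncritical[OF a ext] .
  have nz: "w \<noteq> 0" "w - (A + 1) / 2 \<noteq> 0"
    using nc unfolding poly_p_a w_def A_def by (auto simp: mult.commute[of _ 2])
  have "(w - 1) * (w - A) * (2 * (6 * w - (A + 1))) = - 2 * (2 * z * (2 * w - (A + 1)))\<^sup>2"
    using ext extraneous_fixed_point_noncritical[OF nc] by (simp add: poly_p_a w_def A_def)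
  also have "\<dots> = - 8 * w * (2 * w - (A + 1))\<^sup>2"
    by (simp add: w_def power_mult_distrib)
  finally have "22 * w ^ 3 - 23 * (A + 1) * w\<^sup>2 + (5 * A\<^sup>2 + 16 * A + 5) * w - A * (A + 1) = 0"
    by algebra
  \<comment> \<open>Partial fractions of the cubic over \<open>w * (2 * w - (A + 1))\<close>. The
    two excluded values of \<open>w\<close> are the squares of the critical points, so the division
    is legitimate.\<close>
  then have "11 * w - 6 * (A + 1) + A / w + (2 * A - (A + 1)\<^sup>2 / 2) / (w - (A + 1) / 2) = 0"
    using nz by (simp add: divide_simps) algebra
  then have "of_real 11 * w + of_real (- 6 * (a + 1)) + of_real a / w
      + of_real (2 * a - (a + 1)\<^sup>2 / 2) / (w - of_real ((a + 1) / 2)) = 0"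
    by (simp add: A_def algebra_simps)
  moreover have "2 * a - (a + 1)\<^sup>2 / 2 < 0"
    using a(2) by (smt (verit) zero_le_power2 divide_nonneg_pos)
  moreover have "w \<noteq> of_real ((a + 1) / 2)"
    using nz(2) by (simp add: A_def)
  ultimately show ?thesis
    unfolding w_def[symmetric]
    by (intro pick_function_zero_real[of 11 a "2 * a - (a + 1)\<^sup>2 / 2" w
        "(a + 1) / 2" "- 6 * (a + 1)"]) (use a(2) nz(1) in \<open>assumption | simp\<close>)+
qed

theorem lemma3p11:
  fixes a :: real and z :: complex
  assumes "-1 < a" and "a < 0"
    and "extraneous_fixed_point (p_a (complex_of_real a)) z"
  shows "repelling_fixed_point (chebyshev (p_a (complex_of_real a))) z"
proof -
  let ?p = "p_a (complex_of_real a)"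
  define s where "s = a + 1"
  define x where "x = Re (z\<^sup>2)"
  have z2: "z\<^sup>2 = of_real x"
    using p_a_extraneous_square_real[OF assms] by (simp add: x_def complex_eq_iff)
  have s: "s > 0" "complex_of_real a + 1 = of_real s"
    using assms(1) by (simp_all add: s_def)
  have nc: "poly (pderiv ?p) z \<noteq> 0"
    using p_a_extraneous_noncritical[OF assms] .
  then have "poly (pderiv (pderiv ?p)) z \<noteq> 0"
    using assms(3) extraneous_fixed_point_noncritical[OF nc] by auto
  then have nz: "6 * x - s \<noteq> 0"
    unfolding poly_p_a z2 s by auto
  \<comment> \<open>\<open>p'\<close> and \<open>p'''\<close> are odd and \<open>p''\<close> is
    even, so the multiplier depends on \<open>z\<^sup>2\<close> alone and is real even if
    \<open>z\<close> is purely imaginary.\<close>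
  have "poly (pderiv ?p) z * poly (pderiv (pderiv (pderiv ?p))) z
      = 48 * z\<^sup>2 * (2 * z\<^sup>2 - (complex_of_real a + 1))"
    by (simp add: poly_p_a power2_eq_square)
  then have "deriv (remove_sings (chebyshev ?p)) z
      = of_real (2 * (3 - 48 * x * (2 * x - s) / (2 * (6 * x - s))\<^sup>2))"
    unfolding deriv_chebyshev_extraneous[OF assms(3) nc] by (simp add: poly_p_a z2 s)
  moreover have "2 * (3 - 48 * x * (2 * x - s) / (2 * (6 * x - s))\<^sup>2) > 1"
  proof -
    \<comment> \<open>The left side is
      \<open>5 * (6 * x - s)\<^sup>2 - 24 * x * (2 * x - s)\<close>, the numerator of the multiplier
      minus 1 over \<open>(6 * x - s)\<^sup>2\<close>. Completing the square in \<open>x\<close>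
      leaves a positive multiple of \<open>s\<^sup>2\<close>.\<close>
    have "132 * x\<^sup>2 - 36 * s * x + 5 * s\<^sup>2 = 33 * (2 * x - 3 / 11 * s)\<^sup>2 + 28 / 11 * s\<^sup>2"
      by (simp add: power2_eq_square algebra_simps)
    also have "\<dots> > 0"
      using s(1) by (intro add_nonneg_pos) auto
    finally have "(6 * x - s)\<^sup>2 < 6 * (6 * x - s)\<^sup>2 - 24 * x * (2 * x - s)"
      by (simp add: power2_eq_square algebra_simps)
    then have "1 < (6 * (6 * x - s)\<^sup>2 - 24 * x * (2 * x - s)) / (6 * x - s)\<^sup>2"
      using nz by simp
    also have "\<dots> = 2 * (3 - 48 * x * (2 * x - s) / (2 * (6 * x - s))\<^sup>2)"
      using nz unfolding power_mult_distrib by (simp add: diff_divide_distrib)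
    finally show ?thesis .
  qed
  ultimately have "cmod (deriv (remove_sings (chebyshev ?p)) z) > 1"
    by (simp only: norm_of_real)
  then show ?thesis
    using assms(3) by (simp add: repelling_fixed_point_def extraneous_fixed_point_def)
qed

end
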